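(* Let $u\ge 1$, $b\ge 3$, $k\ge 1$ and $w\ge 0$ be integers with $bk=2u+w$ and $u\ge b-1$. Let $D_0=D_0(u,b,k)$ be the class of connected full designs with parameters $(u,b,k)$. Let $k^{\#}$ be the smallest integer greater than or equal to $2u/(b-1)$, let $k^{+}=2(u+1)-b$, and let $MV_{\min}$ be the minimum value of the $MV$-criterion among connected block designs with $b$ treatments and $u$ blocks, each of size two. Then: (a) If $k\ge k^{\#}$, then $MV(d_0)\ge 2+2\{(b-1)/u\}$ for every $d_0\in D_0$. (b) If $k\ge k^{+}$, then $MV(d_0)\ge 2+MV_{\min}$ for every $d_0\in D_0$.
   Context: A full design $d_0$ with parameters $(u,b,k)$ is a block design with $b$ blocks, each consisting of $k$ plots, each plot receiving one treatment, with $v=u+w$ treatments ($w=bk-2u$): $u$ treatments each occurring on exactly two plots and $w$ treatments each occurring on exactly one plot. A treatment may occur more than once in the same block (binarity is not assumed, for any design here). Model for any block design: the observation from a plot in block $j$ receiving treatment $t$ has expectation (fixed effect of $t$) + (fixed effect of block $j$); observations are uncorrelated with common variance $\sigma^2$. A design is connected if every difference of two treatment effects is estimable. The $MV$-criterion of a connected block design is $\sigma^{-2}$ times the maximum, over all pairs of distinct treatments, of the variance of the best linear unbiased estimator of the difference of the two treatment effects. $MV(d_0)$ denotes the $MV$-criterion of $d_0$ (maximum over all pairs of its $v$ treatments). For a connected block design with $b$ treatments and $u$ blocks of size two (no restriction on replication numbers), with $b\times u$ incidence matrix $M$ and diagonal matrix $R$ of treatment replication numbers, the $MV$-criterion equals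 $\max_{j<j^*}(\tilde e_j-\tilde e_{j^*})^T\tilde C^+(\tilde e_j-\tilde e_{j^*})$, where $\tilde C=R-\tfrac12MM^T$, $\tilde C^+$ is its Moore–Penrose inverse and $\tilde e_1,\dots,\tilde e_b$ are the unit coordinate vectors. *)

theory Defs
  imports Complex_Main
begin

record ('p, 'b, 't) block_design =
  plots :: "'p set"
  blocks :: "'b set"
  treatments :: "'t set"
  block_of :: "'p \<Rightarrow> 'b"
  treatment_of :: "'p \<Rightarrow> 't"

text \<open>Nothing prevents two plots of one block from receiving the same treatment, so designs are
  not assumed to be binary.\<close>

definition is_block_design :: "('p, 'b, 't) block_design \<Rightarrow> bool" where
  "is_block_design d \<longleftrightarrow>
     finite (plots d) \<and> finite (blocks d) \<and> finite (treatments d) \<and>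
     block_of d ` plots d \<subseteq> blocks d \<and> treatment_of d ` plots d \<subseteq> treatments d"

definition block_size :: "('p, 'b, 't) block_design \<Rightarrow> 'b \<Rightarrow> nat" where
  "block_size d j = card {p \<in> plots d. block_of d p = j}"

definition replication :: "('p, 'b, 't) block_design \<Rightarrow> 't \<Rightarrow> nat" where
  "replication d t = card {p \<in> plots d. treatment_of d p = t}"

text \<open>The linear model, given by its first and second moments, with \<open>\<tau>\<close> the treatment effects
  and \<open>\<beta>\<close> the block effects.\<close>

definition obs_expectation ::
    "('p, 'b, 't) block_design \<Rightarrow> ('t \<Rightarrow> real) \<Rightarrow> ('b \<Rightarrow> real) \<Rightarrow> 'p \<Rightarrow> real" where
  "obs_expectation d \<tau> \<beta> p = \<tau> (treatment_of d p) + \<beta> (block_of d p)"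

definition obs_covariance :: "real \<Rightarrow> 'p \<Rightarrow> 'p \<Rightarrow> real" where
  "obs_covariance \<sigma> p q = (if p = q then \<sigma>\<^sup>2 else 0)"

text \<open>A linear estimator \<open>\<Sum>p\<in>plots d. a p * Y p\<close> of the observations \<open>Y\<close> is represented by its
  coefficients \<open>a\<close>; only the values of \<open>a\<close> on \<^term>\<open>plots d\<close> matter.\<close>

definition estimator_expectation ::
    "('p, 'b, 't) block_design \<Rightarrow> ('t \<Rightarrow> real) \<Rightarrow> ('b \<Rightarrow> real) \<Rightarrow> ('p \<Rightarrow> real) \<Rightarrow> real" where
  "estimator_expectation d \<tau> \<beta> a = (\<Sum>p\<in>plots d. a p * obs_expectation d \<tau> \<beta> p)"

definition estimator_variance ::
    "real \<Rightarrow> ('p, 'b, 't) block_design \<Rightarrow> ('p \<Rightarrow> real) \<Rightarrow> real" where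
  "estimator_variance \<sigma> d a = (\<Sum>p\<in>plots d. \<Sum>q\<in>plots d. a p * a q * obs_covariance \<sigma> p q)"

definition unbiased_for_difference ::
    "('p, 'b, 't) block_design \<Rightarrow> 't \<Rightarrow> 't \<Rightarrow> ('p \<Rightarrow> real) \<Rightarrow> bool" where
  "unbiased_for_difference d s t a \<longleftrightarrow> (\<forall>\<tau> \<beta>. estimator_expectation d \<tau> \<beta> a = \<tau> s - \<tau> t)"

definition estimable_difference :: "('p, 'b, 't) block_design \<Rightarrow> 't \<Rightarrow> 't \<Rightarrow> bool" where
  "estimable_difference d s t \<longleftrightarrow> (\<exists>a. unbiased_for_difference d s t a)"

definition connected_design :: "('p, 'b, 't) block_design \<Rightarrow> bool" where
  "connected_design d \<longleftrightarrow> (\<forall>s\<in>treatments d. \<forall>t\<in>treatments d. estimable_difference d s t)"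

text \<open>The best linear unbiased estimator of an estimable difference; its coefficients are unique
  on \<^term>\<open>plots d\<close> when \<open>\<sigma> \<noteq> 0\<close>.\<close>

definition blue :: "real \<Rightarrow> ('p, 'b, 't) block_design \<Rightarrow> 't \<Rightarrow> 't \<Rightarrow> ('p \<Rightarrow> real)" where
  "blue \<sigma> d s t = arg_min (estimator_variance \<sigma> d) (unbiased_for_difference d s t)"

definition MV :: "real \<Rightarrow> ('p, 'b, 't) block_design \<Rightarrow> real" where
  "MV \<sigma> d = (1 / \<sigma>\<^sup>2) *
     Max {estimator_variance \<sigma> d (blue \<sigma> d s t) | s t.
            s \<in> treatments d \<and> t \<in> treatments d \<and> s \<noteq> t}"

definition full_design :: "nat \<Rightarrow> nat \<Rightarrow> nat \<Rightarrow> ('p, 'b, 't) block_design \<Rightarrow> bool" where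
  "full_design u b k d \<longleftrightarrow>
     is_block_design d \<and>
     card (blocks d) = b \<and> (\<forall>j\<in>blocks d. block_size d j = k) \<and>
     (\<forall>t\<in>treatments d. replication d t = 1 \<or> replication d t = 2) \<and>
     card {t \<in> treatments d. replication d t = 2} = u \<and>
     2 * u + card {t \<in> treatments d. replication d t = 1} = b * k"

definition connected_full_designs :: "nat \<Rightarrow> nat \<Rightarrow> nat \<Rightarrow> ('p, 'b, 't) block_design set" where
  "connected_full_designs u b k = {d. full_design u b k d \<and> connected_design d}"

definition connected_size_two_designs ::
    "nat \<Rightarrow> nat \<Rightarrow> ('p, 'b, 't) block_design set" where
  "connected_size_two_designs v n =
     {d. is_block_design d \<and> card (treatments d) = v \<and> card (blocks d) = n \<and>
         (\<forall>j\<in>blocks d. block_size d j = 2) \<and> connected_design d}"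

text \<open>Every finite design can be labelled by natural numbers, and \<^term>\<open>MV \<sigma> d\<close> does not depend on
  the labels. Up to relabelling there are only finitely many designs with \<open>v\<close> treatments
  and \<open>n\<close> blocks of size two, so the set of values below is finite.\<close>

definition MV_min :: "real \<Rightarrow> nat \<Rightarrow> nat \<Rightarrow> real" where
  "MV_min \<sigma> v n =
     Min (MV \<sigma> ` (connected_size_two_designs v n :: (nat, nat, nat) block_design set))"

end

theory Submission
  imports Defs "HOL-Analysis.Convex"
begin

text \<open>Swap the roles of blocks and treatments on the plots of the \<open>u\<close> duplicated treatments: this gives
  a design with \<open>b\<close> treatments and \<open>u\<close> blocks of size two, a multigraph on the blocks of \<open>d\<^sub>0\<close>.
  Two singly replicated treatments lying in blocks \<open>i\<close> and \<open>j\<close> have coefficients \<open>1\<close> and \<open>- 1\<close> on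
  their own plots, and the rest of the estimator of their difference is, up to sign, an unbiased
  estimator of the difference of \<open>i\<close> and \<open>j\<close> in the dual; so its variance exceeds that of the dual
  by at least \<open>2\<close>.

  (b) Since every vertex has positive degree, \<open>k \<ge> k\<^sup>+\<close> leaves no room for a block consisting
  of duplicated treatments only, so all pairs \<open>i, j\<close> of the dual occur.

  (a) Let \<open>S\<close> be the set of the \<open>n\<close> blocks that contain a singly replicated treatment. The other
  blocks have degree \<open>k\<close>, so the degrees over \<open>S\<close> add up to \<open>2u - k(b - n) \<le> 2u(n - 1)/(b - 1)\<close>,
  and Cauchy-Schwarz against differences of block-adjusted indicators, summed over all pairs in
  \<open>S\<close>, bounds the largest dual variance over these pairs from below.\<close>

section \<open>Existence of best linear unbiased estimators\<close>

text \<open>Gram-Schmidt, by induction on \<open>L\<close>: project \<open>a\<close> and the new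
  vector \<open>v x\<close> onto the span of the old ones, then remove from the residual of
  \<open>a\<close> its component along the residual of \<open>v x\<close>. The family may be
  linearly dependent, as treatment and block indicators are.\<close>

lemma orthogonal_residual_exists:
  fixes v :: "'l \<Rightarrow> 'p \<Rightarrow> real"
  assumes "finite L" and P: "finite P"
  shows "\<exists>c. \<forall>l\<in>L. (\<Sum>p\<in>P. (a p - (\<Sum>m\<in>L. c m * v m p)) * v l p) = 0"
  using assms(1)
proof (induction L arbitrary: a)
  case empty
  then show ?case by simp
next
  case (insert x F)
  obtain c where c: "\<forall>l\<in>F. (\<Sum>p\<in>P. (a p - (\<Sum>m\<in>F. c m * v m p)) * v l p) = 0"
    using insert.IH[of a] by blast
  obtain e where e: "\<forall>l\<in>F. (\<Sum>p\<in>P. (v x p - (\<Sum>m\<in>F. e m * v m p)) * v l p) = 0"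
    using insert.IH[of "v x"] by blast
  define r where "r p = a p - (\<Sum>m\<in>F. c m * v m p)" for p
  define z where "z p = v x p - (\<Sum>m\<in>F. e m * v m p)" for p
  \<comment> \<open>If \<open>z\<close> vanishes on \<open>P\<close>, division by zero gives
    \<open>q = 0\<close>. Nothing has to be removed then, because \<open>v x\<close> agrees on
    \<open>P\<close> with a combination of the old vectors.\<close>
  define q where "q = (\<Sum>p\<in>P. r p * z p) / (\<Sum>p\<in>P. z p * z p)"
  \<comment> \<open>The old coefficients change so that the new residual is exactly
    \<open>r - q * z\<close>.\<close>
  define c' where "c' m = (if m = x then q else c m - q * e m)" for m
  have "(\<Sum>m\<in>F. c' m * v m p) = (\<Sum>m\<in>F. c m * v m p) - q * (\<Sum>m\<in>F. e m * v m p)" for p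
  proof -
    have "(\<Sum>m\<in>F. c' m * v m p) = (\<Sum>m\<in>F. c m * v m p - q * (e m * v m p))"
      using insert.hyps by (intro sum.cong) (auto simp: c'_def algebra_simps)
    then show ?thesis by (simp add: sum_subtractf sum_distrib_left)
  qed
  then have res: "a p - (\<Sum>m\<in>insert x F. c' m * v m p) = r p - q * z p" for p
    using insert.hyps by (simp add: r_def z_def c'_def algebra_simps)
  have orthF: "(\<Sum>p\<in>P. (r p - q * z p) * v l p) = 0" if "l \<in> F" for l
  proof -
    have "(\<Sum>p\<in>P. (r p - q * z p) * v l p) = (\<Sum>p\<in>P. r p * v l p) - q * (\<Sum>p\<in>P. z p * v l p)"
      by (simp add: left_diff_distrib sum_subtractf sum_distrib_left mult.assoc)
    then show ?thesis using c e that by (simp add: r_def z_def)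
  qed
  have orthz: "(\<Sum>p\<in>P. (r p - q * z p) * z p) = 0"
  proof -
    have eq: "(\<Sum>p\<in>P. (r p - q * z p) * z p) = (\<Sum>p\<in>P. r p * z p) - q * (\<Sum>p\<in>P. z p * z p)"
      by (simp add: left_diff_distrib sum_subtractf sum_distrib_left mult.assoc)
    show ?thesis
    proof (cases "(\<Sum>p\<in>P. z p * z p) = 0")
      case True
      then have "\<forall>p\<in>P. z p = 0" using P by (subst (asm) sum_nonneg_eq_0_iff) auto
      then show ?thesis by simp
    next
      case False
      then show ?thesis unfolding eq by (simp add: q_def)
    qed
  qed
  have orthx: "(\<Sum>p\<in>P. (r p - q * z p) * v x p) = 0"
  proof -
    have vx: "v x p = z p + (\<Sum>m\<in>F. e m * v m p)" for p by (simp add: z_def)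
    have "(\<Sum>p\<in>P. (r p - q * z p) * v x p)
        = (\<Sum>p\<in>P. (r p - q * z p) * z p) + (\<Sum>p\<in>P. \<Sum>m\<in>F. e m * ((r p - q * z p) * v m p))"
      unfolding sum.distrib[symmetric]
      by (intro sum.cong refl) (simp add: vx distrib_left sum_distrib_left mult.left_commute)
    also have "(\<Sum>p\<in>P. \<Sum>m\<in>F. e m * ((r p - q * z p) * v m p))
        = (\<Sum>m\<in>F. e m * (\<Sum>p\<in>P. (r p - q * z p) * v m p))"
      by (subst sum.swap) (simp add: sum_distrib_left)
    finally show ?thesis using orthz orthF by simp
  qed
  show ?case
    by (intro exI[of _ c']) (use res orthF orthx in simp)
qed

lemma estimator_variance_eq:
  assumes "finite (plots d)"
  shows "estimator_variance \<sigma> d a = \<sigma>\<^sup>2 * (\<Sum>p\<in>plots d. (a p)\<^sup>2)"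
proof -
  have "(\<Sum>q\<in>plots d. a p * a q * obs_covariance \<sigma> p q) = \<sigma>\<^sup>2 * (a p)\<^sup>2" if "p \<in> plots d" for p
  proof -
    have "(\<Sum>q\<in>plots d. a p * a q * obs_covariance \<sigma> p q)
        = (\<Sum>q\<in>plots d. if p = q then \<sigma>\<^sup>2 * (a p)\<^sup>2 else 0)"
      by (intro sum.cong) (auto simp: obs_covariance_def power2_eq_square)
    then show ?thesis using assms that by simp
  qed
  then show ?thesis by (simp add: estimator_variance_def sum_distrib_left)
qed

text \<open>The normal equations: every coefficient vector is an expectation vector plus a part
  orthogonal to all expectation vectors. The latter are spanned by the indicators of single
  treatments and single blocks, indexed below by a disjoint sum.\<close>

lemma least_squares_fit:
  assumes d: "is_block_design d"
  obtains \<tau>0 \<beta>0 where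
    "\<And>\<tau> \<beta>. (\<Sum>p\<in>plots d. (a p - obs_expectation d \<tau>0 \<beta>0 p) * obs_expectation d \<tau> \<beta> p) = 0"
proof -
  let ?P = "plots d" and ?T = "treatments d" and ?B = "blocks d"
  have fin: "finite ?P" "finite ?T" "finite ?B"
    and mem: "\<And>p. p \<in> ?P \<Longrightarrow> treatment_of d p \<in> ?T" "\<And>p. p \<in> ?P \<Longrightarrow> block_of d p \<in> ?B"
    using d unfolding is_block_design_def by auto
  define v :: "'c + 'b \<Rightarrow> 'a \<Rightarrow> real" where
    "v l p = (case l of Inl t \<Rightarrow> of_bool (treatment_of d p = t) | Inr j \<Rightarrow> of_bool (block_of d p = j))"
    for l p
  have comb: "(\<Sum>m\<in>?T <+> ?B. c m * v m p) = obs_expectation d (c \<circ> Inl) (c \<circ> Inr) p"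
    if "p \<in> ?P" for c :: "'c + 'b \<Rightarrow> real" and p
  proof -
    have "(\<Sum>m\<in>?T <+> ?B. c m * v m p)
       = (\<Sum>t\<in>?T. c (Inl t) * of_bool (treatment_of d p = t))
         + (\<Sum>j\<in>?B. c (Inr j) * of_bool (block_of d p = j))"
      using fin by (simp add: sum.Plus v_def)
    also have "(\<Sum>t\<in>?T. c (Inl t) * of_bool (treatment_of d p = t)) = c (Inl (treatment_of d p))"
      using fin mem that by (simp add: of_bool_def if_distrib sum.delta cong: if_cong)
    also have "(\<Sum>j\<in>?B. c (Inr j) * of_bool (block_of d p = j)) = c (Inr (block_of d p))"
      using fin mem that by (simp add: of_bool_def if_distrib sum.delta cong: if_cong)
    finally show ?thesis by (simp add: obs_expectation_def)
  qed
  have "finite (?T <+> ?B)" using fin by simp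
  from orthogonal_residual_exists[OF this fin(1), of a v]
  obtain c where c: "\<And>l. l \<in> ?T <+> ?B \<Longrightarrow>
      (\<Sum>p\<in>?P. (a p - (\<Sum>m\<in>?T <+> ?B. c m * v m p)) * v l p) = 0"
    by blast
  define r where "r p = a p - obs_expectation d (c \<circ> Inl) (c \<circ> Inr) p" for p
  have r: "(\<Sum>p\<in>?P. r p * v l p) = 0" if "l \<in> ?T <+> ?B" for l
    using c[OF that] by (simp add: comb r_def cong: sum.cong)
  have "(\<Sum>p\<in>?P. r p * obs_expectation d \<tau> \<beta> p) = 0" for \<tau> \<beta>
  proof -
    define e where "e = case_sum \<tau> \<beta>"
    have "(\<Sum>p\<in>?P. r p * obs_expectation d \<tau> \<beta> p)
        = (\<Sum>p\<in>?P. r p * (\<Sum>m\<in>?T <+> ?B. e m * v m p))"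
      by (intro sum.cong) (simp_all add: comb e_def obs_expectation_def)
    also have "\<dots> = (\<Sum>m\<in>?T <+> ?B. e m * (\<Sum>p\<in>?P. r p * v m p))"
      unfolding sum_distrib_left by (subst sum.swap) (simp add: algebra_simps)
    finally show ?thesis using r by simp
  qed
  then show thesis using that unfolding r_def by blast
qed

text \<open>The Gauss-Markov argument. It is needed because \<open>arg_min\<close> carries
  information only once a minimiser exists. The projection \<open>x\<close> of any unbiased
  estimator onto the expectation vectors is still unbiased, and for every unbiased \<open>y\<close>
  the vector \<open>y - x\<close> is orthogonal to \<open>x\<close>, so Pythagoras gives
  minimality.\<close>

lemma blue_optimal:
  assumes d: "is_block_design d" and est: "estimable_difference d s t"
  shows unbiased_blue: "unbiased_for_difference d s t (blue \<sigma> d s t)"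
    and blue_minimal: "unbiased_for_difference d s t a \<Longrightarrow>
      estimator_variance \<sigma> d (blue \<sigma> d s t) \<le> estimator_variance \<sigma> d a"
proof -
  have fin: "finite (plots d)" using d by (simp add: is_block_design_def)
  obtain a0 where a0: "unbiased_for_difference d s t a0"
    using est unfolding estimable_difference_def by blast
  obtain \<tau>0 \<beta>0 where orth:
    "\<And>\<tau> \<beta>. (\<Sum>p\<in>plots d. (a0 p - obs_expectation d \<tau>0 \<beta>0 p) * obs_expectation d \<tau> \<beta> p) = 0"
    using least_squares_fit[OF d] by blast
  define x where "x = obs_expectation d \<tau>0 \<beta>0"
  have x: "unbiased_for_difference d s t x"
    using a0 orth unfolding unbiased_for_difference_def estimator_expectation_def x_def
    by (simp add: left_diff_distrib sum_subtractf)
  have min: "estimator_variance \<sigma> d x \<le> estimator_variance \<sigma> d y"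
    if y: "unbiased_for_difference d s t y" for y
  proof -
    \<comment> \<open>Unbiasedness of \<open>x\<close> and of \<open>y\<close>, tested at the
      effects \<open>\<tau>0\<close>, \<open>\<beta>0\<close>: the expectation vector there is
      \<open>x\<close> itself, so both sums equal the same difference of effects.\<close>
    have "(\<Sum>p\<in>plots d. y p * x p) = (\<Sum>p\<in>plots d. x p * x p)"
      using x y unfolding unbiased_for_difference_def estimator_expectation_def x_def by simp
    moreover have "(\<Sum>p\<in>plots d. (y p - x p)\<^sup>2) =
        (\<Sum>p\<in>plots d. (y p)\<^sup>2) - 2 * (\<Sum>p\<in>plots d. y p * x p) + (\<Sum>p\<in>plots d. x p * x p)"
      unfolding sum_distrib_left sum_subtractf[symmetric] sum.distrib[symmetric]
      by (intro sum.cong) (simp_all add: power2_eq_square algebra_simps)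
    moreover have "(\<Sum>p\<in>plots d. (y p - x p)\<^sup>2) \<ge> 0" by (intro sum_nonneg) simp
    ultimately have "(\<Sum>p\<in>plots d. (x p)\<^sup>2) \<le> (\<Sum>p\<in>plots d. (y p)\<^sup>2)"
      by (simp add: power2_eq_square)
    then show ?thesis using fin by (simp add: estimator_variance_eq mult_left_mono)
  qed
  have "unbiased_for_difference d s t (blue \<sigma> d s t) \<and>
     (\<forall>a. unbiased_for_difference d s t a \<longrightarrow>
        estimator_variance \<sigma> d (blue \<sigma> d s t) \<le> estimator_variance \<sigma> d a)"
    unfolding blue_def by (rule arg_minI[where x = x]) (use x min in \<open>auto simp: not_less\<close>)
  then show "unbiased_for_difference d s t (blue \<sigma> d s t)"
    and "unbiased_for_difference d s t a \<Longrightarrow>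
      estimator_variance \<sigma> d (blue \<sigma> d s t) \<le> estimator_variance \<sigma> d a"
    by auto
qed

section \<open>The MV-criterion as an attained maximum\<close>

lemma finite_MV_values:
  assumes "is_block_design d"
  shows "finite {estimator_variance \<sigma> d (blue \<sigma> d s t) | s t.
            s \<in> treatments d \<and> t \<in> treatments d \<and> s \<noteq> t}"
proof -
  have "{estimator_variance \<sigma> d (blue \<sigma> d s t) | s t.
            s \<in> treatments d \<and> t \<in> treatments d \<and> s \<noteq> t}
      \<subseteq> (\<lambda>(s, t). estimator_variance \<sigma> d (blue \<sigma> d s t)) ` (treatments d \<times> treatments d)"
    by auto
  moreover have "finite (treatments d)" using assms by (simp add: is_block_design_def)
  ultimately show ?thesis by (elim finite_subset) (intro finite_imageI finite_cartesian_product)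
qed

lemma blue_variance_le_MV:
  assumes "is_block_design d" "\<sigma> > 0" "s \<in> treatments d" "t \<in> treatments d" "s \<noteq> t"
  shows "(\<Sum>p\<in>plots d. (blue \<sigma> d s t p)\<^sup>2) \<le> MV \<sigma> d"
proof -
  have "estimator_variance \<sigma> d (blue \<sigma> d s t) \<le> Max {estimator_variance \<sigma> d (blue \<sigma> d s t) | s t.
            s \<in> treatments d \<and> t \<in> treatments d \<and> s \<noteq> t}"
    by (rule Max_ge[OF finite_MV_values[OF assms(1)]]) (use assms in blast)
  then have "(1 / \<sigma>\<^sup>2) * estimator_variance \<sigma> d (blue \<sigma> d s t) \<le> MV \<sigma> d"
    unfolding MV_def by (intro mult_left_mono) auto
  moreover have "finite (plots d)" using assms(1) by (simp add: is_block_design_def)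
  ultimately show ?thesis using assms(2) by (simp add: estimator_variance_eq)
qed

text \<open>Two treatments make the set of variances nonempty, so that its \<open>Max\<close> is one
  of its members.\<close>

lemma MV_attained:
  assumes "is_block_design d" "\<sigma> > 0" "card (treatments d) \<ge> 2"
  obtains s t where "s \<in> treatments d" "t \<in> treatments d" "s \<noteq> t"
    "MV \<sigma> d = (\<Sum>p\<in>plots d. (blue \<sigma> d s t p)\<^sup>2)"
proof -
  let ?V = "{estimator_variance \<sigma> d (blue \<sigma> d s t) | s t.
            s \<in> treatments d \<and> t \<in> treatments d \<and> s \<noteq> t}"
  have "finite (treatments d)" using assms(1) by (simp add: is_block_design_def)
  with assms(3) obtain s t where "s \<in> treatments d" "t \<in> treatments d" "s \<noteq> t"
    using card_le_Suc0_iff_eq[of "treatments d"] by auto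
  then have "?V \<noteq> {}" by blast
  from Max_in[OF finite_MV_values[OF assms(1)] this]
  obtain s t where st: "s \<in> treatments d" "t \<in> treatments d" "s \<noteq> t"
    and "Max ?V = estimator_variance \<sigma> d (blue \<sigma> d s t)" by blast
  moreover have "finite (plots d)" using assms(1) by (simp add: is_block_design_def)
  ultimately have "MV \<sigma> d = (\<Sum>p\<in>plots d. (blue \<sigma> d s t p)\<^sup>2)"
    using assms(2) by (simp add: MV_def estimator_variance_eq)
  with st that show thesis by blast
qed

section \<open>Relabelling\<close>

text \<open>The maps matter only on the carrier sets. In particular, records whose assignment
  functions differ off the plots count as the same design.\<close>

definition design_iso ::
    "('p \<Rightarrow> 'q) \<Rightarrow> ('b \<Rightarrow> 'c) \<Rightarrow> ('t \<Rightarrow> 's) \<Rightarrow> ('p, 'b, 't) block_design \<Rightarrow> ('q, 'c, 's) block_design \<Rightarrow> bool" where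
  "design_iso f g h d d' \<longleftrightarrow>
     bij_betw f (plots d) (plots d') \<and> bij_betw g (blocks d) (blocks d') \<and>
     bij_betw h (treatments d) (treatments d') \<and>
     (\<forall>p\<in>plots d. block_of d' (f p) = g (block_of d p) \<and>
                   treatment_of d' (f p) = h (treatment_of d p))"

lemma design_iso_is_block_design:
  assumes i: "design_iso f g h d d'" and d: "is_block_design d"
  shows "is_block_design d'"
proof -
  have P: "plots d' = f ` plots d" and B: "blocks d' = g ` blocks d"
    and T: "treatments d' = h ` treatments d"
    using i unfolding design_iso_def bij_betw_def by auto
  have "block_of d' (f p) \<in> g ` blocks d" "treatment_of d' (f p) \<in> h ` treatments d"
    if "p \<in> plots d" for p
    using i d that unfolding design_iso_def is_block_design_def by auto
  then show ?thesis using d unfolding is_block_design_def P B T by auto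
qed

lemma design_iso_sym:
  assumes i: "design_iso f g h d d'" and d: "is_block_design d"
  shows "design_iso (inv_into (plots d) f) (inv_into (blocks d) g) (inv_into (treatments d) h) d' d"
proof -
  have bf: "bij_betw f (plots d) (plots d')" and bg: "bij_betw g (blocks d) (blocks d')"
    and bh: "bij_betw h (treatments d) (treatments d')"
    using i unfolding design_iso_def by auto
  have "block_of d (inv_into (plots d) f q) = inv_into (blocks d) g (block_of d' q) \<and>
      treatment_of d (inv_into (plots d) f q) = inv_into (treatments d) h (treatment_of d' q)"
    if q: "q \<in> plots d'" for q
  proof -
    obtain p where p: "p \<in> plots d" "q = f p" using bf q unfolding bij_betw_def by auto
    then have "block_of d p \<in> blocks d" "treatment_of d p \<in> treatments d"
      using d unfolding is_block_design_def by auto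
    then show ?thesis
      using p i bf bg bh unfolding design_iso_def by (simp add: bij_betw_inv_into_left)
  qed
  then show ?thesis
    unfolding design_iso_def using bij_betw_inv_into[OF bf] bij_betw_inv_into[OF bg]
      bij_betw_inv_into[OF bh] by blast
qed

text \<open>Effects of \<open>d\<close> are transported to \<open>d'\<close> along the inverse label
  maps. Corresponding plots then have equal expectations, so estimators pull back along
  \<open>f\<close> without bias.\<close>

lemma design_iso_unbiased:
  fixes d :: "('a, 'b, 'c) block_design"
  assumes i: "design_iso f g h d d'" and d: "is_block_design d"
    and s: "s \<in> treatments d" and t: "t \<in> treatments d"
    and a: "unbiased_for_difference d' (h s) (h t) a"
  shows "unbiased_for_difference d s t (a \<circ> f)"
  unfolding unbiased_for_difference_def
proof (intro allI)
  fix \<tau> :: "'c \<Rightarrow> real" and \<beta> :: "'b \<Rightarrow> real"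
  have bf: "bij_betw f (plots d) (plots d')" and bg: "bij_betw g (blocks d) (blocks d')"
    and bh: "bij_betw h (treatments d) (treatments d')"
    using i unfolding design_iso_def by auto
  define \<tau>' where "\<tau>' = \<tau> \<circ> inv_into (treatments d) h"
  define \<beta>' where "\<beta>' = \<beta> \<circ> inv_into (blocks d) g"
  have obs: "obs_expectation d' \<tau>' \<beta>' (f p) = obs_expectation d \<tau> \<beta> p" if "p \<in> plots d" for p
  proof -
    have "block_of d p \<in> blocks d" "treatment_of d p \<in> treatments d"
      using d that unfolding is_block_design_def by auto
    then show ?thesis using i that bg bh
      unfolding design_iso_def obs_expectation_def \<tau>'_def \<beta>'_def
      by (simp add: bij_betw_inv_into_left)
  qed
  have "estimator_expectation d \<tau> \<beta> (a \<circ> f)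
      = (\<Sum>p\<in>plots d. a (f p) * obs_expectation d' \<tau>' \<beta>' (f p))"
    unfolding estimator_expectation_def by (intro sum.cong) (simp_all add: obs)
  also have "\<dots> = estimator_expectation d' \<tau>' \<beta>' a"
    unfolding estimator_expectation_def
    using sum.reindex_bij_betw[OF bf, of "\<lambda>q. a q * obs_expectation d' \<tau>' \<beta>' q"] .
  also have "\<dots> = \<tau>' (h s) - \<tau>' (h t)" using a unfolding unbiased_for_difference_def by blast
  also have "\<dots> = \<tau> s - \<tau> t" using s t bh by (simp add: \<tau>'_def bij_betw_inv_into_left)
  finally show "estimator_expectation d \<tau> \<beta> (a \<circ> f) = \<tau> s - \<tau> t" .
qed

lemma design_iso_estimable:
  assumes "design_iso f g h d d'" "is_block_design d" "s \<in> treatments d" "t \<in> treatments d"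
    and "estimable_difference d' (h s) (h t)"
  shows "estimable_difference d s t"
  using design_iso_unbiased[OF assms(1-4)] assms(5) unfolding estimable_difference_def by metis

lemma design_iso_connected:
  assumes i: "design_iso f g h d d'" and d: "is_block_design d" and c: "connected_design d'"
  shows "connected_design d"
  unfolding connected_design_def
proof (intro ballI)
  fix s t assume st: "s \<in> treatments d" "t \<in> treatments d"
  then have "h s \<in> treatments d'" "h t \<in> treatments d'"
    using i unfolding design_iso_def bij_betw_def by auto
  then show "estimable_difference d s t"
    using design_iso_estimable[OF i d st] c unfolding connected_design_def by blast
qed

lemma design_iso_blue_variance_le:
  assumes i: "design_iso f g h d d'" and d: "is_block_design d"
    and s: "s \<in> treatments d" and t: "t \<in> treatments d"
    and e: "estimable_difference d' (h s) (h t)"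
  shows "estimator_variance \<sigma> d (blue \<sigma> d s t) \<le> estimator_variance \<sigma> d' (blue \<sigma> d' (h s) (h t))"
proof -
  have d': "is_block_design d'" by (rule design_iso_is_block_design[OF i d])
  have fin: "finite (plots d)" "finite (plots d')" using d d' by (simp_all add: is_block_design_def)
  have bf: "bij_betw f (plots d) (plots d')" using i unfolding design_iso_def by auto
  let ?a = "blue \<sigma> d' (h s) (h t)"
  have "unbiased_for_difference d s t (?a \<circ> f)"
    using design_iso_unbiased[OF i d s t unbiased_blue[OF d' e]] .
  from blue_minimal[OF d design_iso_estimable[OF i d s t e] this]
  have "estimator_variance \<sigma> d (blue \<sigma> d s t) \<le> estimator_variance \<sigma> d (?a \<circ> f)" .
  also have "\<dots> = estimator_variance \<sigma> d' ?a"
    using sum.reindex_bij_betw[OF bf, of "\<lambda>q. (?a q)\<^sup>2"] fin by (simp add: estimator_variance_eq)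
  finally show ?thesis .
qed

text \<open>Pulling back the best estimator gives one inequality between variances, and the inverse
  isomorphism gives the other. Connectedness ensures that each \<open>blue\<close> involved really
  is a minimiser.\<close>

lemma design_iso_MV:
  assumes i: "design_iso f g h d d'" and d: "is_block_design d" and c: "connected_design d"
  shows "MV \<sigma> d = MV \<sigma> d'"
proof -
  have d': "is_block_design d'" by (rule design_iso_is_block_design[OF i d])
  note i' = design_iso_sym[OF i d]
  have c': "connected_design d'" by (rule design_iso_connected[OF i' d' c])
  have bh: "bij_betw h (treatments d) (treatments d')" using i unfolding design_iso_def by auto
  have ht: "h s \<in> treatments d'" if "s \<in> treatments d" for s
    using bh that unfolding bij_betw_def by auto
  have eq: "estimator_variance \<sigma> d (blue \<sigma> d s t) = estimator_variance \<sigma> d' (blue \<sigma> d' (h s) (h t))"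
    if st: "s \<in> treatments d" "t \<in> treatments d" for s t
  proof (rule antisym)
    show "estimator_variance \<sigma> d (blue \<sigma> d s t) \<le> estimator_variance \<sigma> d' (blue \<sigma> d' (h s) (h t))"
      using design_iso_blue_variance_le[OF i d st] c' ht st unfolding connected_design_def by blast
    show "estimator_variance \<sigma> d' (blue \<sigma> d' (h s) (h t)) \<le> estimator_variance \<sigma> d (blue \<sigma> d s t)"
      using design_iso_blue_variance_le[OF i' d' ht ht, of s t \<sigma>] st c bh
      unfolding connected_design_def by (simp add: bij_betw_inv_into_left)
  qed
  have "{estimator_variance \<sigma> d (blue \<sigma> d s t) | s t.
            s \<in> treatments d \<and> t \<in> treatments d \<and> s \<noteq> t}
      = {estimator_variance \<sigma> d' (blue \<sigma> d' s t) | s t.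
            s \<in> treatments d' \<and> t \<in> treatments d' \<and> s \<noteq> t}" (is "?A = ?B")
  proof
    show "?A \<subseteq> ?B"
    proof
      fix x assume "x \<in> ?A"
      then obtain s t where st: "s \<in> treatments d" "t \<in> treatments d" "s \<noteq> t"
        and x: "x = estimator_variance \<sigma> d (blue \<sigma> d s t)" by blast
      moreover have "h s \<noteq> h t" using bh st unfolding bij_betw_def inj_on_def by blast
      ultimately show "x \<in> ?B" using eq ht by blast
    qed
    show "?B \<subseteq> ?A"
    proof
      fix x assume "x \<in> ?B"
      then obtain s t where st: "s \<in> treatments d'" "t \<in> treatments d'" "s \<noteq> t"
        and x: "x = estimator_variance \<sigma> d' (blue \<sigma> d' s t)" by blast
      then obtain s0 t0 where "s = h s0" "t = h t0" "s0 \<in> treatments d" "t0 \<in> treatments d"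
        using bh unfolding bij_betw_def by blast
      then have "x = estimator_variance \<sigma> d (blue \<sigma> d s0 t0)" "s0 \<noteq> t0" using eq st x by auto
      with \<open>s0 \<in> _\<close> \<open>t0 \<in> _\<close> show "x \<in> ?A" by blast
    qed
  qed
  then show ?thesis unfolding MV_def by simp
qed

section \<open>Canonical labels and the minimum over designs with blocks of size two\<close>

lemma card_plots_eq_sum:
  assumes "is_block_design d"
  shows "card (plots d) = (\<Sum>j\<in>blocks d. block_size d j)"
proof -
  have "finite (plots d)" "finite (blocks d)" "block_of d ` plots d \<subseteq> blocks d"
    using assms unfolding is_block_design_def by auto
  from sum.group[OF this, of "\<lambda>_. 1::nat"] show ?thesis
    by (simp add: block_size_def)
qed

text \<open>The extensional function spaces \<open>\<rightarrow>\<^sub>E\<close> fix the values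
  outside \<open>{..<N}\<close>; otherwise one labelled design would correspond to infinitely many
  records.\<close>

definition canonical_designs :: "nat \<Rightarrow> nat \<Rightarrow> nat \<Rightarrow> (nat, nat, nat) block_design set" where
  "canonical_designs N n v =
     (\<lambda>(\<phi>, \<psi>). \<lparr>plots = {..<N}, blocks = {..<n}, treatments = {..<v}, block_of = \<phi>, treatment_of = \<psi>\<rparr>)
       ` (({..<N} \<rightarrow>\<^sub>E {..<n}) \<times> ({..<N} \<rightarrow>\<^sub>E {..<v}))"

lemma finite_canonical_designs: "finite (canonical_designs N n v)"
  unfolding canonical_designs_def by (intro finite_imageI finite_cartesian_product finite_PiE) auto

lemma canonical_design_exists:
  assumes d: "is_block_design d"
  obtains f g h d' where "design_iso f g h d d'"
    "d' \<in> canonical_designs (card (plots d)) (card (blocks d)) (card (treatments d))"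
proof -
  have fin: "finite (plots d)" "finite (blocks d)" "finite (treatments d)"
    using d unfolding is_block_design_def by auto
  obtain f where f: "bij_betw f (plots d) {..<card (plots d)}"
    using ex_bij_betw_finite_nat[OF fin(1)] by (auto simp: atLeast0LessThan)
  obtain g where g: "bij_betw g (blocks d) {..<card (blocks d)}"
    using ex_bij_betw_finite_nat[OF fin(2)] by (auto simp: atLeast0LessThan)
  obtain h where h: "bij_betw h (treatments d) {..<card (treatments d)}"
    using ex_bij_betw_finite_nat[OF fin(3)] by (auto simp: atLeast0LessThan)
  let ?N = "card (plots d)"
  define \<phi> where "\<phi> = restrict (\<lambda>q. g (block_of d (inv_into (plots d) f q))) {..<?N}"
  define \<psi> where "\<psi> = restrict (\<lambda>q. h (treatment_of d (inv_into (plots d) f q))) {..<?N}"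
  define d' where "d' = \<lparr>plots = {..<?N}, blocks = {..<card (blocks d)},
      treatments = {..<card (treatments d)}, block_of = \<phi>, treatment_of = \<psi>\<rparr>"
  have mem: "g (block_of d p) < card (blocks d)" "h (treatment_of d p) < card (treatments d)"
    if "p \<in> plots d" for p
    using that d bij_betwE[OF g] bij_betwE[OF h] unfolding is_block_design_def by auto
  have inv: "inv_into (plots d) f q \<in> plots d" if "q < ?N" for q
    using that bij_betwE[OF bij_betw_inv_into[OF f]] by auto
  have "design_iso f g h d d'"
    using f g h bij_betwE[OF f] unfolding design_iso_def d'_def \<phi>_def \<psi>_def
    by (auto simp: bij_betw_inv_into_left)
  moreover have "d' \<in> canonical_designs ?N (card (blocks d)) (card (treatments d))"
    unfolding canonical_designs_def d'_def
    by (rule image_eqI[where x = "(\<phi>, \<psi>)"]) (auto simp: \<phi>_def \<psi>_def mem inv)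
  ultimately show thesis using that by blast
qed

text \<open>Block size two forces \<open>2 * n\<close> plots, so every such design is isomorphic to
  one of finitely many canonical designs with the same criterion value. This makes the
  \<open>Min\<close> in \<open>MV_min\<close> meaningful.\<close>

lemma finite_MV_size_two:
  "finite (MV \<sigma> ` (connected_size_two_designs v n :: (nat, nat, nat) block_design set))"
proof -
  have "MV \<sigma> d \<in> MV \<sigma> ` canonical_designs (2 * n) n v"
    if "d \<in> connected_size_two_designs v n" for d :: "(nat, nat, nat) block_design"
  proof -
    have d: "is_block_design d" "connected_design d" "card (treatments d) = v" "card (blocks d) = n"
      and "\<forall>j\<in>blocks d. block_size d j = 2"
      using that unfolding connected_size_two_designs_def by auto
    then have "card (plots d) = 2 * n" by (simp add: card_plots_eq_sum)
    with d(3,4) obtain f g h d' where i: "design_iso f g h d d'"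
      and "d' \<in> canonical_designs (2 * n) n v"
      using canonical_design_exists[OF d(1)] by metis
    then show ?thesis using design_iso_MV[OF i d(1,2)] by simp
  qed
  then have "MV \<sigma> ` (connected_size_two_designs v n :: (nat, nat, nat) block_design set)
      \<subseteq> MV \<sigma> ` canonical_designs (2 * n) n v"
    by (rule image_subsetI)
  then show ?thesis by (rule finite_subset) (intro finite_imageI finite_canonical_designs)
qed

text \<open>\<open>MV_min\<close> ranges over designs labelled by natural numbers only; the dual of
  a full design carries arbitrary labels and is first relabelled.\<close>

lemma MV_min_le:
  assumes e: "e \<in> connected_size_two_designs v n"
  shows "MV_min \<sigma> v n \<le> MV \<sigma> e"
proof -
  have d: "is_block_design e" "connected_design e" "card (treatments e) = v" "card (blocks e) = n"
    and two: "\<forall>j\<in>blocks e. block_size e j = 2"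
    using e unfolding connected_size_two_designs_def by auto
  obtain f g h and e' :: "(nat, nat, nat) block_design" where i: "design_iso f g h e e'"
    by (rule canonical_design_exists[OF d(1)])
  have e': "is_block_design e'" by (rule design_iso_is_block_design[OF i d(1)])
  have c': "connected_design e'"
    by (rule design_iso_connected[OF design_iso_sym[OF i d(1)] e' d(2)])
  have bf: "bij_betw f (plots e) (plots e')" and bg: "bij_betw g (blocks e) (blocks e')"
    and bh: "bij_betw h (treatments e) (treatments e')"
    using i unfolding design_iso_def by auto
  have "block_size e' j' = 2" if j': "j' \<in> blocks e'" for j'
  proof -
    obtain j where j: "j \<in> blocks e" "j' = g j" using j' bij_betw_imp_surj_on[OF bg] by blast
    have key: "block_of e' (f p) = j' \<longleftrightarrow> block_of e p = j" if p: "p \<in> plots e" for p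
    proof -
      have "block_of e p \<in> blocks e" using d(1) p unfolding is_block_design_def by auto
      moreover have "block_of e' (f p) = g (block_of e p)"
        using i p unfolding design_iso_def by blast
      ultimately show ?thesis
        using j inj_on_eq_iff[OF bij_betw_imp_inj_on[OF bg]] by simp
    qed
    have "plots e' = f ` plots e" using bf unfolding bij_betw_def by simp
    then have "{q \<in> plots e'. block_of e' q = j'} = f ` {p \<in> plots e. block_of e p = j}"
      using key by (simp add: set_eq_iff image_iff) blast
    moreover have "inj_on f {p \<in> plots e. block_of e p = j}"
      by (rule inj_on_subset[OF bij_betw_imp_inj_on[OF bf]]) auto
    ultimately have "block_size e' j' = block_size e j"
      unfolding block_size_def by (simp only: card_image)
    then show ?thesis using bspec[OF two j(1)] by (rule trans)
  qed
  then have "e' \<in> connected_size_two_designs v n"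
    unfolding connected_size_two_designs_def
    using e' c' d(3,4) bij_betw_same_card[OF bg] bij_betw_same_card[OF bh] by simp
  then have "MV_min \<sigma> v n \<le> MV \<sigma> e'"
    unfolding MV_min_def by (intro Min_le finite_MV_size_two imageI)
  then show ?thesis using design_iso_MV[OF i d(1,2), of \<sigma>] by simp
qed

section \<open>Pairs of treatments in a design with blocks of size two\<close>

lemma sum_over_plots_by_block:
  fixes F :: "'p \<Rightarrow> real"
  assumes "is_block_design d"
  shows "(\<Sum>p\<in>plots d. F p) = (\<Sum>B\<in>blocks d. \<Sum>p | p \<in> plots d \<and> block_of d p = B. F p)"
proof -
  have "finite (plots d)" "finite (blocks d)" "block_of d ` plots d \<subseteq> blocks d"
    using assms unfolding is_block_design_def by auto
  from sum.group[OF this, of F] show ?thesis by simp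
qed

lemma card_plots_eq_sum_replication:
  assumes "is_block_design d"
  shows "card (plots d) = (\<Sum>t\<in>treatments d. replication d t)"
proof -
  have "finite (plots d)" "finite (treatments d)" "treatment_of d ` plots d \<subseteq> treatments d"
    using assms unfolding is_block_design_def by auto
  from sum.group[OF this, of "\<lambda>_. 1::nat"] show ?thesis by (simp add: replication_def)
qed

text \<open>The block effects are chosen so that the values sum to zero over every block of size two.\<close>

definition adjusted_indicator :: "('p, 'b, 't) block_design \<Rightarrow> 't \<Rightarrow> 'p \<Rightarrow> real" where
  "adjusted_indicator d i = obs_expectation d (\<lambda>t. of_bool (t = i))
     (\<lambda>B. - real (card {q \<in> plots d. block_of d q = B \<and> treatment_of d q = i}) / 2)"

text \<open>With \<open>N B\<close> the number of occurrences of \<open>i\<close> in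
  \<open>B\<close>, the sum equals the replication minus half the sum of
  \<open>(N B)\<^sup>2\<close>. Since \<open>N B\<close> is a natural number, its square is at least
  \<open>N B\<close>, and the \<open>N B\<close> add up to the replication. A block containing
  \<open>i\<close> twice contributes nothing to the left side.\<close>

lemma sum_adjusted_indicator_squared_le:
  assumes d: "is_block_design d" and two: "\<forall>j\<in>blocks d. block_size d j = 2"
  shows "(\<Sum>p\<in>plots d. (adjusted_indicator d i p)\<^sup>2) \<le> real (replication d i) / 2"
proof -
  have fin: "finite (plots d)" using d by (simp add: is_block_design_def)
  define N where "N B = real (card {q \<in> plots d. block_of d q = B \<and> treatment_of d q = i})" for B
  define x :: "'a \<Rightarrow> real" where "x p = of_bool (treatment_of d p = i)" for p
  have xsum: "(\<Sum>p | p \<in> plots d \<and> block_of d p = B. x p) = N B" for B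
  proof -
    have "(\<Sum>p | p \<in> plots d \<and> block_of d p = B. x p)
        = (\<Sum>p | p \<in> plots d \<and> block_of d p = B \<and> treatment_of d p = i. x p)"
      using fin by (intro sum.mono_neutral_right) (auto simp: x_def)
    also have "\<dots> = N B" by (simp add: x_def N_def)
    finally show ?thesis .
  qed
  have "(\<Sum>p\<in>plots d. x p) = (\<Sum>p | p \<in> plots d \<and> treatment_of d p = i. x p)"
    using fin by (intro sum.mono_neutral_right) (auto simp: x_def)
  then have r: "(\<Sum>p\<in>plots d. x p) = real (replication d i)" by (simp add: x_def replication_def)
  have g: "adjusted_indicator d i p = x p - N (block_of d p) / 2" for p
    by (simp add: adjusted_indicator_def obs_expectation_def x_def N_def)
  have "(adjusted_indicator d i p)\<^sup>2 = x p - x p * N (block_of d p) + (N (block_of d p))\<^sup>2 / 4" for p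
    unfolding g by (cases "treatment_of d p = i") (simp_all add: x_def power2_eq_square field_simps)
  then have "(\<Sum>p\<in>plots d. (adjusted_indicator d i p)\<^sup>2) = real (replication d i)
      - (\<Sum>p\<in>plots d. x p * N (block_of d p)) + (\<Sum>p\<in>plots d. (N (block_of d p))\<^sup>2 / 4)"
    by (simp add: sum.distrib sum_subtractf r)
  also have "(\<Sum>p\<in>plots d. x p * N (block_of d p)) = (\<Sum>B\<in>blocks d. (N B)\<^sup>2)"
  proof -
    have "(\<Sum>p | p \<in> plots d \<and> block_of d p = B. x p * N (block_of d p)) = (N B)\<^sup>2" for B
    proof -
      have "(\<Sum>p | p \<in> plots d \<and> block_of d p = B. x p * N (block_of d p))
          = (\<Sum>p | p \<in> plots d \<and> block_of d p = B. x p) * N B"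
        unfolding sum_distrib_right by (intro sum.cong) auto
      then show ?thesis by (simp add: xsum power2_eq_square)
    qed
    then show ?thesis by (simp add: sum_over_plots_by_block[OF d])
  qed
  also have "(\<Sum>p\<in>plots d. (N (block_of d p))\<^sup>2 / 4) = (\<Sum>B\<in>blocks d. (N B)\<^sup>2) / 2"
  proof -
    have "(\<Sum>p | p \<in> plots d \<and> block_of d p = B. (N (block_of d p))\<^sup>2 / 4) = (N B)\<^sup>2 / 2"
      if "B \<in> blocks d" for B
      using two that by (simp add: block_size_def)
    then show ?thesis
      unfolding sum_over_plots_by_block[OF d] sum_divide_distrib by (rule sum.cong[OF refl])
  qed
  finally have eq: "(\<Sum>p\<in>plots d. (adjusted_indicator d i p)\<^sup>2)
      = real (replication d i) - (\<Sum>B\<in>blocks d. (N B)\<^sup>2) / 2" by simp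
  have "real (replication d i) = (\<Sum>B\<in>blocks d. N B)"
    unfolding r[symmetric] by (simp add: sum_over_plots_by_block[OF d] xsum)
  also have "\<dots> \<le> (\<Sum>B\<in>blocks d. (N B)\<^sup>2)"
  proof (rule sum_mono)
    fix B
    have "m \<le> m * m" for m :: nat by (cases m) auto
    then show "N B \<le> (N B)\<^sup>2" unfolding N_def power2_eq_square of_nat_mult[symmetric] of_nat_le_iff .
  qed
  finally show ?thesis using eq by simp
qed

text \<open>Each adjusted indicator is an expectation vector. The estimator therefore returns the
  difference of treatment effects, which is \<open>1\<close> for the indicator of \<open>i\<close>
  and \<open>- 1\<close> for that of \<open>j\<close>; the block adjustments drop out.\<close>

lemma sum_adjusted_indicator_unbiased:
  assumes "unbiased_for_difference d i j a" "i \<noteq> j"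
  shows "(\<Sum>p\<in>plots d. a p * (adjusted_indicator d i p - adjusted_indicator d j p)) = 2"
  using assms
  unfolding unbiased_for_difference_def estimator_expectation_def adjusted_indicator_def
  by (simp add: right_diff_distrib sum_subtractf)

text \<open>Expanding the squares leaves exactly \<open>2 * (\<Sum>i\<in>S. y i)\<^sup>2\<close> as
  the difference of the two sides.\<close>

lemma sum_pairwise_squared_diff_le:
  fixes y :: "'a \<Rightarrow> real"
  shows "(\<Sum>i\<in>S. \<Sum>j\<in>S. (y i - y j)\<^sup>2) \<le> 2 * real (card S) * (\<Sum>i\<in>S. (y i)\<^sup>2)"
proof -
  have "(\<Sum>i\<in>S. \<Sum>j\<in>S. (y i - y j)\<^sup>2) = 2 * real (card S) * (\<Sum>i\<in>S. (y i)\<^sup>2) - 2 * (\<Sum>i\<in>S. y i)\<^sup>2"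
    by (simp add: power2_diff sum.distrib sum_subtractf sum_distrib_left[symmetric]
        sum_distrib_right[symmetric] mult.assoc power2_eq_square[of "sum y S"])
  then show ?thesis by simp
qed

text \<open>In electrical terms, this bounds from below the largest effective resistance between vertices
  of \<open>S\<close>; for \<open>S\<close> the set of all vertices it is a consequence of Foster's theorem.\<close>

lemma size_two_variance_bound:
  assumes d: "is_block_design d" and two: "\<forall>j\<in>blocks d. block_size d j = 2"
    and S: "S \<subseteq> treatments d" "S \<noteq> {}"
    and un: "\<And>i j. i \<in> S \<Longrightarrow> j \<in> S \<Longrightarrow> i \<noteq> j \<Longrightarrow>
      \<exists>a. unbiased_for_difference d i j a \<and> (\<Sum>p\<in>plots d. (a p)\<^sup>2) \<le> \<rho>"
    and \<rho>: "0 \<le> \<rho>"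
  shows "4 * (real (card S) - 1) \<le> \<rho> * real (\<Sum>i\<in>S. replication d i)"
proof -
  have finS: "finite S" using S d finite_subset unfolding is_block_design_def by blast
  let ?n = "real (card S)"
  let ?G = "\<lambda>i j. \<Sum>p\<in>plots d. (adjusted_indicator d i p - adjusted_indicator d j p)\<^sup>2"
  \<comment> \<open>The \<open>4\<close> is the square of the value \<open>2\<close> that an
    unbiased estimator takes on the difference of two adjusted indicators. Summed over the ordered
    pairs below, it gives \<open>4 * n * (n - 1)\<close>, where \<open>n\<close> is the cardinality
    of \<open>S\<close>.\<close>
  have pair: "(if i = j then 0 else 4) \<le> \<rho> * ?G i j" if ij: "i \<in> S" "j \<in> S" for i j
  proof (cases "i = j")
    case False
    then obtain a where a: "unbiased_for_difference d i j a" "(\<Sum>p\<in>plots d. (a p)\<^sup>2) \<le> \<rho>"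
      using un ij by blast
    have "2\<^sup>2 \<le> (\<Sum>p\<in>plots d. (a p)\<^sup>2) * ?G i j"
      unfolding sum_adjusted_indicator_unbiased[OF a(1) False, symmetric]
      by (rule Cauchy_Schwarz_ineq_sum)
    also have "\<dots> \<le> \<rho> * ?G i j" using a(2) by (intro mult_right_mono sum_nonneg) auto
    finally show ?thesis using False by simp
  qed simp
  have "(\<Sum>i\<in>S. \<Sum>j\<in>S. if i = j then 0 else 4::real) = (\<Sum>i\<in>S. 4 * (?n - 1))"
  proof (rule sum.cong[OF refl])
    fix i assume i: "i \<in> S"
    have "(\<Sum>j\<in>S. if i = j then 0 else 4::real) = (\<Sum>j\<in>S. 4 - (if i = j then 4 else 0))"
      by (intro sum.cong) auto
    then show "(\<Sum>j\<in>S. if i = j then 0 else 4::real) = 4 * (?n - 1)"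
      using finS i by (simp add: sum_subtractf)
  qed
  then have "?n * (4 * (?n - 1)) = (\<Sum>i\<in>S. \<Sum>j\<in>S. if i = j then 0 else 4::real)" by simp
  also have "\<dots> \<le> (\<Sum>i\<in>S. \<Sum>j\<in>S. \<rho> * ?G i j)" by (intro sum_mono pair)
  also have "\<dots> = \<rho> * (\<Sum>p\<in>plots d. \<Sum>i\<in>S. \<Sum>j\<in>S.
      (adjusted_indicator d i p - adjusted_indicator d j p)\<^sup>2)"
    unfolding sum_distrib_left[symmetric]
    by (simp add: sum.swap[where A = S and B = "plots d"])
  also have "\<dots> \<le> \<rho> * (\<Sum>p\<in>plots d. 2 * ?n * (\<Sum>i\<in>S. (adjusted_indicator d i p)\<^sup>2))"
    by (intro mult_left_mono sum_mono sum_pairwise_squared_diff_le \<rho>)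
  also have "\<dots> = \<rho> * (2 * ?n * (\<Sum>i\<in>S. \<Sum>p\<in>plots d. (adjusted_indicator d i p)\<^sup>2))"
    by (simp add: sum_distrib_left[symmetric] sum.swap[where A = S and B = "plots d"])
  also have "\<dots> \<le> \<rho> * (2 * ?n * (\<Sum>i\<in>S. real (replication d i) / 2))"
    by (intro mult_left_mono sum_mono sum_adjusted_indicator_squared_le d two \<rho>) simp
  also have "\<dots> = ?n * (\<rho> * real (\<Sum>i\<in>S. replication d i))"
    by (simp add: sum_divide_distrib[symmetric])
  finally show ?thesis using finS S(2) by (simp add: card_gt_0_iff)
qed

section \<open>The dual of the twice-replicated part of a full design\<close>

text \<open>As a multigraph, each duplicated treatment is an edge joining the blocks of its two
  plots, and a loop if these coincide. Every block of \<open>d\<close> is kept as a vertex, so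
  isolated vertices are not excluded by the construction.\<close>

definition dual_design :: "('p, 'b, 't) block_design \<Rightarrow> ('p, 't, 'b) block_design" where
  "dual_design d = \<lparr>plots = {p \<in> plots d. replication d (treatment_of d p) = 2},
     blocks = {t \<in> treatments d. replication d t = 2}, treatments = blocks d,
     block_of = treatment_of d, treatment_of = block_of d\<rparr>"

lemma dual_design_simps [simp]:
  "plots (dual_design d) = {p \<in> plots d. replication d (treatment_of d p) = 2}"
  "blocks (dual_design d) = {t \<in> treatments d. replication d t = 2}"
  "treatments (dual_design d) = blocks d"
  "block_of (dual_design d) = treatment_of d"
  "treatment_of (dual_design d) = block_of d"
  by (simp_all add: dual_design_def)

lemma is_block_design_dual:
  assumes "is_block_design d" shows "is_block_design (dual_design d)"
  using assms unfolding is_block_design_def by auto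

lemma block_size_dual:
  assumes "t \<in> blocks (dual_design d)"
  shows "block_size (dual_design d) t = 2"
proof -
  have "{p \<in> plots (dual_design d). block_of (dual_design d) p = t}
      = {p \<in> plots d. treatment_of d p = t}"
    using assms by auto
  then show ?thesis using assms by (simp add: block_size_def replication_def)
qed

text \<open>The handshake identity: the dual plots are counted by vertex and by edge.\<close>

lemma sum_replication_dual:
  assumes "full_design u b k d"
  shows "(\<Sum>j\<in>blocks d. replication (dual_design d) j) = 2 * u"
proof -
  have "is_block_design (dual_design d)" "card (blocks (dual_design d)) = u"
    using assms is_block_design_dual unfolding full_design_def by auto
  then show ?thesis
    using card_plots_eq_sum_replication[of "dual_design d"] card_plots_eq_sum[of "dual_design d"]
    by (simp add: block_size_dual del: dual_design_simps(1,2))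
qed

section \<open>Singly replicated treatments and estimators in the dual\<close>

lemma plot_of_single_unique:
  assumes "replication d (treatment_of d p) = 1" "p \<in> plots d" "q \<in> plots d"
    "treatment_of d q = treatment_of d p"
  shows "q = p"
proof -
  obtain r where r: "{q \<in> plots d. treatment_of d q = treatment_of d p} = {r}"
    using assms(1) unfolding replication_def by (rule card_1_singletonE)
  then have "p \<in> {r}" "q \<in> {r}" using assms(2-4) by auto
  then show ?thesis by simp
qed

lemma replication_plot_cases:
  assumes "full_design u b k d" "p \<in> plots d"
  shows "replication d (treatment_of d p) = 1 \<or> replication d (treatment_of d p) = 2"
  using assms unfolding full_design_def is_block_design_def by blast

text \<open>Dual effects become effects in \<open>d\<close> with the roles swapped, and every plot
  of a singly replicated treatment gets expectation zero. Only the dual plots contribute, while the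
  estimated difference is that of the cancelling effects \<open>- \<tau>'\<close>, whence the change
  of sign.\<close>

lemma dual_unbiased:
  assumes d: "full_design u b k d" and p: "p \<in> plots d" and q: "q \<in> plots d"
    and single: "replication d (treatment_of d p) = 1" "replication d (treatment_of d q) = 1"
    and a: "unbiased_for_difference d (treatment_of d p) (treatment_of d q) a"
  shows "unbiased_for_difference (dual_design d) (block_of d p) (block_of d q) (\<lambda>r. - a r)"
  unfolding unbiased_for_difference_def
proof (intro allI)
  fix \<tau>' :: "'b \<Rightarrow> real" and \<beta>' :: "'c \<Rightarrow> real"
  \<comment> \<open>The effect of a singly replicated treatment is chosen to cancel the block effect on its plot.\<close>
  define \<tau> where "\<tau> t = (if replication d t = 2 then \<beta>' t
      else - \<tau>' (block_of d (THE r. r \<in> plots d \<and> treatment_of d r = t)))" for t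
  have fin: "finite (plots d)" using d unfolding full_design_def is_block_design_def by blast
  have \<tau>1: "\<tau> (treatment_of d r) = - \<tau>' (block_of d r)"
    if "r \<in> plots d" "replication d (treatment_of d r) = 1" for r
  proof -
    have "(THE r'. r' \<in> plots d \<and> treatment_of d r' = treatment_of d r) = r"
      using that plot_of_single_unique[OF that(2,1)] by (intro the_equality) auto
    then show ?thesis using that by (simp add: \<tau>_def)
  qed
  have "(\<Sum>r\<in>plots (dual_design d). a r * obs_expectation (dual_design d) \<tau>' \<beta>' r)
      = (\<Sum>r\<in>plots d. a r * obs_expectation d \<tau> \<tau>' r)"
  proof (rule sum.mono_neutral_cong_left[OF fin])
    show "\<forall>r\<in>plots d - plots (dual_design d). a r * obs_expectation d \<tau> \<tau>' r = 0"
    proof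
      fix r assume "r \<in> plots d - plots (dual_design d)"
      then have "r \<in> plots d" "replication d (treatment_of d r) = 1"
        using replication_plot_cases[OF d] by auto
      then show "a r * obs_expectation d \<tau> \<tau>' r = 0" by (simp add: obs_expectation_def \<tau>1)
    qed
  qed (auto simp: obs_expectation_def \<tau>_def)
  also have "\<dots> = \<tau> (treatment_of d p) - \<tau> (treatment_of d q)"
    using a unfolding unbiased_for_difference_def estimator_expectation_def by blast
  finally show "estimator_expectation (dual_design d) \<tau>' \<beta>' (\<lambda>r. - a r)
      = \<tau>' (block_of d p) - \<tau>' (block_of d q)"
    using p q single by (simp add: estimator_expectation_def sum_negf \<tau>1)
qed

text \<open>Test unbiasedness with treatment effect \<open>1\<close> on the treatment of
  \<open>p\<close>, and \<open>0\<close> on all other treatments and blocks: only the plot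
  \<open>p\<close> has nonzero expectation.\<close>

lemma unbiased_at_single_plots:
  assumes fin: "finite (plots d)" and p: "p \<in> plots d"
    and single: "replication d (treatment_of d p) = 1"
    and a: "unbiased_for_difference d s t a"
  shows "a p = of_bool (s = treatment_of d p) - of_bool (t = treatment_of d p)"
proof -
  let ?\<tau> = "\<lambda>x. of_bool (x = treatment_of d p) :: real"
  have "?\<tau> s - ?\<tau> t = (\<Sum>r\<in>plots d. a r * obs_expectation d ?\<tau> (\<lambda>_. 0) r)"
    using a unfolding unbiased_for_difference_def estimator_expectation_def by metis
  also have "\<dots> = (\<Sum>r\<in>{p}. a r)"
    using p plot_of_single_unique[OF single p]
    by (intro sum.mono_neutral_cong_right[OF fin]) (auto simp: obs_expectation_def)
  finally show ?thesis by simp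
qed

text \<open>The plots \<open>p\<close> and \<open>q\<close> lie outside the dual and carry
  coefficients \<open>1\<close> and \<open>- 1\<close>, which accounts for the \<open>2\<close>.
  They may lie in the same block.\<close>

lemma dual_estimator_of_singles:
  assumes d: "full_design u b k d" "connected_design d" and \<sigma>: "\<sigma> > 0"
    and p: "p \<in> plots d" and q: "q \<in> plots d" and pq: "p \<noteq> q"
    and single: "replication d (treatment_of d p) = 1" "replication d (treatment_of d q) = 1"
  obtains a where "unbiased_for_difference (dual_design d) (block_of d p) (block_of d q) a"
    "(\<Sum>r\<in>plots (dual_design d). (a r)\<^sup>2) \<le> MV \<sigma> d - 2"
proof -
  let ?s = "treatment_of d p" and ?t = "treatment_of d q"
  have bd: "is_block_design d" using d(1) unfolding full_design_def by blast
  then have fin: "finite (plots d)" and st: "?s \<in> treatments d" "?t \<in> treatments d"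
    using p q unfolding is_block_design_def by auto
  have ne: "?s \<noteq> ?t" using plot_of_single_unique[OF single(1) p q] pq by auto
  define a where "a = blue \<sigma> d ?s ?t"
  have "estimable_difference d ?s ?t" using d(2) st unfolding connected_design_def by blast
  then have a: "unbiased_for_difference d ?s ?t a" unfolding a_def by (rule unbiased_blue[OF bd])
  have ap: "a p = 1" using unbiased_at_single_plots[OF fin p single(1) a] ne by simp
  have aq: "a q = - 1" using unbiased_at_single_plots[OF fin q single(2) a] ne by simp
  have "(\<Sum>r\<in>plots (dual_design d). (a r)\<^sup>2) + 2
      = (\<Sum>r\<in>plots (dual_design d) \<union> {p, q}. (a r)\<^sup>2)"
    using fin single pq ap aq by (subst sum.union_disjoint) auto
  also have "\<dots> \<le> (\<Sum>r\<in>plots d. (a r)\<^sup>2)"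
    using fin p q by (intro sum_mono2) auto
  also have "\<dots> \<le> MV \<sigma> d"
    unfolding a_def by (rule blue_variance_le_MV[OF bd \<sigma> st ne])
  finally have "(\<Sum>r\<in>plots (dual_design d). (- a r)\<^sup>2) \<le> MV \<sigma> d - 2" by simp
  with dual_unbiased[OF d(1) p q single a] show thesis by (rule that)
qed

text \<open>If all treatments of block \<open>j\<close> were singly replicated, raising the effect
  of \<open>j\<close> by \<open>1\<close> and lowering the effects of its treatments by
  \<open>1\<close> would change no expectation. It would change the difference between such a
  treatment and a duplicated one, contradicting connectedness. Here \<open>k \<ge> 1\<close>
  provides the former treatment and \<open>u \<ge> 1\<close> the latter.\<close>

lemma replication_dual_pos:
  assumes d: "full_design u b k d" "connected_design d" and u: "u \<ge> 1" and k: "k \<ge> 1"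
    and j: "j \<in> blocks d"
  shows "replication (dual_design d) j \<ge> 1"
proof (rule ccontr)
  have bd: "is_block_design d" using d(1) unfolding full_design_def by blast
  then have fin: "finite (plots d)" unfolding is_block_design_def by blast
  assume "\<not> 1 \<le> replication (dual_design d) j"
  then have "card {p \<in> plots (dual_design d). treatment_of (dual_design d) p = j} = 0"
    unfolding replication_def[of "dual_design d"] by linarith
  then have "{p \<in> plots (dual_design d). block_of d p = j} = {}" using fin by simp
  then have single: "replication d (treatment_of d p) = 1" if "p \<in> plots d" "block_of d p = j" for p
    using replication_plot_cases[OF d(1) that(1)] that by auto
  have "card {p \<in> plots d. block_of d p = j} = k"
    using d(1) j unfolding full_design_def block_size_def by blast
  with k have "{p \<in> plots d. block_of d p = j} \<noteq> {}" by (metis card.empty not_one_le_zero)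
  then obtain p where p: "p \<in> plots d" "block_of d p = j" by blast
  have "card {t \<in> treatments d. replication d t = 2} = u"
    using d(1) unfolding full_design_def by blast
  with u have "{t \<in> treatments d. replication d t = 2} \<noteq> {}" by (metis card.empty not_one_le_zero)
  then obtain t where t: "t \<in> treatments d" "replication d t = 2" by blast
  have "treatment_of d p \<in> treatments d" using bd p unfolding is_block_design_def by auto
  then obtain a where a: "unbiased_for_difference d (treatment_of d p) t a"
    using d(2) t unfolding connected_design_def estimable_difference_def by blast
  define \<tau> :: "'c \<Rightarrow> real" where
    "\<tau> x = - of_bool (\<exists>q\<in>plots d. block_of d q = j \<and> treatment_of d q = x)" for x
  have "obs_expectation d \<tau> (\<lambda>B. of_bool (B = j)) r = 0" if r: "r \<in> plots d" for r
  proof (cases "block_of d r = j")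
    case True
    then show ?thesis using r by (auto simp: obs_expectation_def \<tau>_def)
  next
    case False
    \<comment> \<open>A treatment of block \<open>j\<close> has its only plot in \<open>j\<close>,
      so the lowered effects are not felt in other blocks.\<close>
    then have "\<not> (\<exists>q\<in>plots d. block_of d q = j \<and> treatment_of d q = treatment_of d r)"
      using plot_of_single_unique[OF single] r by metis
    then show ?thesis using False by (simp add: obs_expectation_def \<tau>_def)
  qed
  then have "estimator_expectation d \<tau> (\<lambda>B. of_bool (B = j)) a = 0"
    by (simp add: estimator_expectation_def)
  then have "\<tau> (treatment_of d p) = \<tau> t"
    using a unfolding unbiased_for_difference_def by simp
  moreover have "\<tau> (treatment_of d p) = - 1" using p by (auto simp: \<tau>_def)
  moreover have "\<tau> t = 0" using t single by (auto simp: \<tau>_def)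
  ultimately show False by simp
qed

lemma replication_dual_no_single:
  assumes d: "full_design u b k d" and j: "j \<in> blocks d"
    and "\<not> (\<exists>p\<in>plots d. block_of d p = j \<and> replication d (treatment_of d p) = 1)"
  shows "replication (dual_design d) j = k"
proof -
  have "{p \<in> plots (dual_design d). treatment_of (dual_design d) p = j}
      = {p \<in> plots d. block_of d p = j}"
    using replication_plot_cases[OF d] assms(3) by auto
  then show ?thesis using d j
    by (simp add: replication_def full_design_def block_size_def del: dual_design_simps)
qed

section \<open>The two lower bounds for the MV-criterion\<close>

lemma MV_ge_average:
  assumes d: "full_design u b k d" "connected_design d"
    and u: "u \<ge> 1" and b: "b \<ge> 2" and k: "k \<ge> 1" and \<sigma>: "\<sigma> > 0"
    and k2: "2 * real u \<le> real k * (real b - 1)"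
  shows "MV \<sigma> d \<ge> 2 + 2 * ((real b - 1) / real u)"
proof -
  define S where
    "S = {j \<in> blocks d. \<exists>p\<in>plots d. block_of d p = j \<and> replication d (treatment_of d p) = 1}"
  have bd: "is_block_design d" and cb: "card (blocks d) = b"
    using d(1) unfolding full_design_def by auto
  have finB: "finite (blocks d)" using bd unfolding is_block_design_def by blast
  have SB: "S \<subseteq> blocks d" unfolding S_def by auto
  define n where "n = card S"
  have finS: "finite S" using SB finB finite_subset by blast
  have nb: "n \<le> b" unfolding n_def cb[symmetric] by (rule card_mono[OF finB SB])
  define R where "R = (\<Sum>i\<in>S. replication (dual_design d) i)"
  have "(\<Sum>i\<in>blocks d - S. replication (dual_design d) i) = (\<Sum>i\<in>blocks d - S. k)"
    by (intro sum.cong refl replication_dual_no_single[OF d(1)]) (auto simp: S_def)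
  also have "\<dots> = (b - n) * k"
    using card_Diff_subset[OF finS SB] by (simp add: cb n_def)
  finally have "R + (b - n) * k = 2 * u"
    using sum.subset_diff[OF SB finB, of "replication (dual_design d)"]
      sum_replication_dual[OF d(1)] by (simp add: R_def)
  then have "real (R + (b - n) * k) = real (2 * u)" by simp
  then have R: "real R = 2 * real u - (real b - real n) * real k" using nb by simp
  have Rn: "n \<le> R"
  proof -
    have "(\<Sum>i\<in>S. 1) \<le> R"
      unfolding R_def using replication_dual_pos[OF d u k] SB by (intro sum_mono) auto
    then show ?thesis by (simp add: n_def)
  qed
  \<comment> \<open>The formula for \<open>R\<close> and the bound on \<open>k\<close> give
    \<open>R \<le> (n - 1) * k\<close> over the reals. For \<open>n = 0\<close> this is negative,
    and for \<open>n = 1\<close> it contradicts \<open>n \<le> R\<close>.\<close>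
  have n2: "n \<ge> 2"
  proof (rule ccontr)
    assume "\<not> n \<ge> 2"
    then consider "n = 0" | "n = 1" by linarith
    then show False
    proof cases
      case 1
      then have "real R \<le> - real k" using R k2 by (simp add: algebra_simps)
      then show False using k by simp
    next
      case 2
      then have "real R \<le> 0" using R k2 by (simp add: algebra_simps)
      then show False using Rn 2 by simp
    qed
  qed
  have pair: "\<exists>a. unbiased_for_difference (dual_design d) i j a \<and>
      (\<Sum>p\<in>plots (dual_design d). (a p)\<^sup>2) \<le> MV \<sigma> d - 2" if ij: "i \<in> S" "j \<in> S" "i \<noteq> j" for i j
  proof -
    obtain p q where "p \<in> plots d" "block_of d p = i" "replication d (treatment_of d p) = 1"
      and "q \<in> plots d" "block_of d q = j" "replication d (treatment_of d q) = 1"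
      using ij unfolding S_def by blast
    then show ?thesis using dual_estimator_of_singles[OF d \<sigma>, of p q] ij(3) by metis
  qed
  \<comment> \<open>A sum of squares lies below this number; \<open>n \<ge> 2\<close> supplies a
    pair for which such a sum is available.\<close>
  have \<rho>: "0 \<le> MV \<sigma> d - 2"
  proof -
    obtain i j where "i \<in> S" "j \<in> S" "i \<noteq> j"
      using n2 card_le_Suc0_iff_eq[OF finS] unfolding n_def by auto
    then obtain a :: "'a \<Rightarrow> real" where "(\<Sum>p\<in>plots (dual_design d). (a p)\<^sup>2) \<le> MV \<sigma> d - 2"
      using pair by blast
    then show ?thesis using order_trans[OF sum_nonneg] by (metis zero_le_power2)
  qed
  have "4 * (real n - 1) \<le> (MV \<sigma> d - 2) * real R"
    unfolding n_def R_def
  proof (rule size_two_variance_bound)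
    show "S \<noteq> {}" using n2 by (auto simp: n_def)
  qed (use is_block_design_dual[OF bd] block_size_dual[of _ d] SB pair \<rho> in auto)
  \<comment> \<open>The factor \<open>b - 1\<close> prepares for the degree bound
    \<open>R * (b - 1) \<le> 2 * u * (n - 1)\<close>, after which the positive factor
    \<open>n - 1\<close> cancels and the bound no longer depends on \<open>S\<close>.\<close>
  then have "4 * (real n - 1) * (real b - 1) \<le> (MV \<sigma> d - 2) * real R * (real b - 1)"
    using b by (intro mult_right_mono) auto
  also have "\<dots> = (MV \<sigma> d - 2) * (real R * (real b - 1))" by simp
  also have "\<dots> \<le> (MV \<sigma> d - 2) * (2 * real u * (real n - 1))"
  proof (rule mult_left_mono[OF _ \<rho>])
    have "2 * real u * (real b - real n) \<le> real k * (real b - 1) * (real b - real n)"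
      using k2 nb by (intro mult_right_mono) auto
    then show "real R * (real b - 1) \<le> 2 * real u * (real n - 1)"
      unfolding R by (simp add: algebra_simps)
  qed
  finally have "(real n - 1) * (2 * (real b - 1)) \<le> (real n - 1) * ((MV \<sigma> d - 2) * real u)"
    by (simp add: algebra_simps)
  then have "2 * (real b - 1) \<le> (MV \<sigma> d - 2) * real u" using n2 by simp
  then show ?thesis using u by (simp add: field_simps)
qed

lemma MV_ge_MV_min:
  assumes d: "full_design u b k d" "connected_design d"
    and u: "u \<ge> 1" and b: "b \<ge> 2" and k: "k \<ge> 1" and \<sigma>: "\<sigma> > 0"
    and kp: "k + b \<ge> 2 * u + 2"
  shows "MV \<sigma> d \<ge> 2 + MV_min \<sigma> b u"
proof -
  have bd: "is_block_design d" and cb: "card (blocks d) = b"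
    and cu: "card {t \<in> treatments d. replication d t = 2} = u"
    using d(1) unfolding full_design_def by auto
  have finB: "finite (blocks d)" using bd unfolding is_block_design_def by blast
  \<comment> \<open>A block without a singly replicated treatment has dual degree \<open>k\<close>,
    and the other \<open>b - 1\<close> blocks have degree at least \<open>1\<close>. The total would
    be at least \<open>k + b - 1 \<ge> 2 * u + 1\<close>, whereas it is
    \<open>2 * u\<close>.\<close>
  have single: "\<exists>p\<in>plots d. block_of d p = j \<and> replication d (treatment_of d p) = 1"
    if j: "j \<in> blocks d" for j
  proof (rule ccontr)
    assume "\<not> ?thesis"
    then have "replication (dual_design d) j = k" by (rule replication_dual_no_single[OF d(1) j])
    moreover have "(\<Sum>i\<in>blocks d - {j}. 1) \<le> (\<Sum>i\<in>blocks d - {j}. replication (dual_design d) i)"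
      using replication_dual_pos[OF d u k] by (intro sum_mono) auto
    moreover have "2 * u = replication (dual_design d) j
        + (\<Sum>i\<in>blocks d - {j}. replication (dual_design d) i)"
      unfolding sum_replication_dual[OF d(1), symmetric] by (rule sum.remove[OF finB j])
    ultimately show False using kp b finB j cb by simp
  qed
  have est: "\<exists>a. unbiased_for_difference (dual_design d) i j a \<and>
      (\<Sum>p\<in>plots (dual_design d). (a p)\<^sup>2) \<le> MV \<sigma> d - 2"
    if ij: "i \<in> blocks d" "j \<in> blocks d" "i \<noteq> j" for i j
  proof -
    obtain p q where "p \<in> plots d" "block_of d p = i" "replication d (treatment_of d p) = 1"
      and "q \<in> plots d" "block_of d q = j" "replication d (treatment_of d q) = 1"
      using single ij by meson
    then show ?thesis using dual_estimator_of_singles[OF d \<sigma>, of p q] ij(3) by metis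
  qed
  have bd': "is_block_design (dual_design d)" by (rule is_block_design_dual[OF bd])
  have "estimable_difference (dual_design d) i j" if "i \<in> blocks d" "j \<in> blocks d" for i j
  proof (cases "i = j")
    case True
    then have "unbiased_for_difference (dual_design d) i j (\<lambda>_. 0)"
      by (simp add: unbiased_for_difference_def estimator_expectation_def)
    then show ?thesis unfolding estimable_difference_def by blast
  next
    case False
    then show ?thesis using est that unfolding estimable_difference_def by blast
  qed
  then have conn: "connected_design (dual_design d)" by (simp add: connected_design_def)
  then have "dual_design d \<in> connected_size_two_designs b u"
    unfolding connected_size_two_designs_def using bd' block_size_dual[of _ d] cb cu by simp
  then have "MV_min \<sigma> b u \<le> MV \<sigma> (dual_design d)" by (rule MV_min_le)
  \<comment> \<open>At a pair where the dual criterion is attained, the best estimator does no worse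
    than the one inherited from \<open>d\<close>.\<close>
  also have "\<dots> \<le> MV \<sigma> d - 2"
  proof -
    obtain i j where ij: "i \<in> blocks d" "j \<in> blocks d" "i \<noteq> j"
      and MV: "MV \<sigma> (dual_design d) = (\<Sum>p\<in>plots (dual_design d). (blue \<sigma> (dual_design d) i j p)\<^sup>2)"
      using MV_attained[OF bd' \<sigma>] b cb by auto
    obtain a where a: "unbiased_for_difference (dual_design d) i j a"
      "(\<Sum>p\<in>plots (dual_design d). (a p)\<^sup>2) \<le> MV \<sigma> d - 2"
      using est ij by blast
    have "estimable_difference (dual_design d) i j"
      using a(1) unfolding estimable_difference_def by blast
    from blue_minimal[OF bd' this a(1), of \<sigma>]
    have "MV \<sigma> (dual_design d) \<le> (\<Sum>p\<in>plots (dual_design d). (a p)\<^sup>2)"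
      using bd' \<sigma> unfolding MV by (simp add: estimator_variance_eq is_block_design_def)
    with a(2) show ?thesis by simp
  qed
  finally show ?thesis by simp
qed

theorem theorem2:
  fixes u b k w :: nat and \<sigma> :: real
  assumes "u \<ge> 1" and "b \<ge> 3" and "k \<ge> 1" and "w \<ge> 0"
    and "b * k = 2 * u + w" and "u \<ge> b - 1" and "\<sigma> > 0"
  shows "(int k \<ge> \<lceil>2 * real u / (real b - 1)\<rceil> \<longrightarrow>
            (\<forall>d\<in>(connected_full_designs u b k :: ('p, 'b, 't) block_design set).
               MV \<sigma> d \<ge> 2 + 2 * ((real b - 1) / real u))) \<and>
         (int k \<ge> 2 * (int u + 1) - int b \<longrightarrow>
            (\<forall>d\<in>(connected_full_designs u b k :: ('p, 'b, 't) block_design set).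
               MV \<sigma> d \<ge> 2 + MV_min \<sigma> b u))"
proof (intro conjI impI ballI)
  fix d :: "('p, 'b, 't) block_design"
  assume "\<lceil>2 * real u / (real b - 1)\<rceil> \<le> int k" and d: "d \<in> connected_full_designs u b k"
  then have "2 * real u / (real b - 1) \<le> real k" by linarith
  then have "2 * real u \<le> real k * (real b - 1)" using assms(2) by (simp add: field_simps)
  then show "2 + 2 * ((real b - 1) / real u) \<le> MV \<sigma> d"
    using d assms unfolding connected_full_designs_def by (intro MV_ge_average) auto
next
  fix d :: "('p, 'b, 't) block_design"
  assume "2 * (int u + 1) - int b \<le> int k" and d: "d \<in> connected_full_designs u b k"
  \<comment> \<open>Moving \<open>b\<close> to the other side avoids truncated subtraction when
    passing to natural numbers.\<close>
  then have "int (2 * u + 2) \<le> int (k + b)" by simp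
  then have "2 * u + 2 \<le> k + b" by (simp only: of_nat_le_iff)
  then show "2 + MV_min \<sigma> b u \<le> MV \<sigma> d"
    using d assms unfolding connected_full_designs_def by (intro MV_ge_MV_min) auto
qed

end
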